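(* Let $J$ be an unbounded subinterval of $\mathbb{R}$ and $g:J\to\mathbb{R}$ a locally absolutely continuous function on $J$. Suppose that $g'\in L_1(J)$, that the derivative $g':J\to\mathbb{R}$ is of locally bounded variation, and that there exist constants $V_J>0$ and $r\in(0,1]$ such that $$\left|\bigvee\nolimits_a^b(g')\right|\le V_J|a-b|^r\quad\text{for any } a,b\in J.$$ Then $g'\in L_\infty(J)$ and $$\|g'\|_{J,\infty}\le \frac{r+1}{r^{\frac{r}{r+1}}}\,\|g'\|_{J,1}^{\frac{r}{r+1}}\,V_J^{\frac{1}{r+1}}.$$
   Context: $\|\cdot\|_{J,\infty}$ is the essential supremum norm on $J$ and $\|h\|_{J,1}=\int_J|h(t)|\,dt$. For $a<b$, $\bigvee_a^b(h)$ denotes the total variation of $h$ on $[a,b]$; for arbitrary $a,b\in J$, $\left|\bigvee_a^b(h)\right|$ is the total variation of $h$ on the closed interval with endpoints $a$ and $b$ (in either order). *)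

theory Defs
  imports "HOL-Analysis.Analysis" "HOL-Probability.Essential_Supremum"
begin

definition abs_continuous_on_interval :: "real \<Rightarrow> real \<Rightarrow> (real \<Rightarrow> real) \<Rightarrow> bool" where
  "abs_continuous_on_interval a b f \<longleftrightarrow>
     (\<forall>\<epsilon>>0. \<exists>\<delta>>0. \<forall>(n::nat) (u::nat \<Rightarrow> real) (v::nat \<Rightarrow> real).
        (\<forall>i<n. a \<le> u i \<and> u i \<le> v i \<and> v i \<le> b) \<longrightarrow>
        (\<forall>i<n. \<forall>j<n. i \<noteq> j \<longrightarrow> {u i<..<v i} \<inter> {u j<..<v j} = {}) \<longrightarrow>
        (\<Sum>i<n. v i - u i) < \<delta> \<longrightarrow>
        (\<Sum>i<n. \<bar>f (v i) - f (u i)\<bar>) < \<epsilon>)"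

definition locally_abs_continuous_on :: "real set \<Rightarrow> (real \<Rightarrow> real) \<Rightarrow> bool" where
  "locally_abs_continuous_on J f \<longleftrightarrow>
     (\<forall>a b. a \<le> b \<longrightarrow> {a..b} \<subseteq> J \<longrightarrow> abs_continuous_on_interval a b f)"

text \<open>The total variation on \<open>[a, b]\<close> takes values in \<open>[0, \<infinity>]\<close>; it is meant for \<open>a \<le> b\<close>.
  Partitions are allowed to repeat points, which does not change the supremum.\<close>

definition total_variation :: "real \<Rightarrow> real \<Rightarrow> (real \<Rightarrow> real) \<Rightarrow> ennreal" where
  "total_variation a b h =
     (SUP (n, x) \<in> {(n::nat, x::nat \<Rightarrow> real). x 0 = a \<and> x n = b \<and> (\<forall>i<n. x i \<le> x (Suc i))}.
        \<Sum>i<n. ennreal \<bar>h (x (Suc i)) - h (x i)\<bar>)"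

definition abs_total_variation :: "real \<Rightarrow> real \<Rightarrow> (real \<Rightarrow> real) \<Rightarrow> ennreal" where
  "abs_total_variation a b h = total_variation (min a b) (max a b) h"

definition locally_bounded_variation_on :: "real set \<Rightarrow> (real \<Rightarrow> real) \<Rightarrow> bool" where
  "locally_bounded_variation_on J h \<longleftrightarrow>
     (\<forall>a b. a \<le> b \<longrightarrow> {a..b} \<subseteq> J \<longrightarrow> total_variation a b h < \<infinity>)"

definition L1_norm_on :: "real set \<Rightarrow> (real \<Rightarrow> real) \<Rightarrow> real" where
  "L1_norm_on J h = (LINT t|lebesgue_on J. \<bar>h t\<bar>)"

definition Linf_norm_on :: "real set \<Rightarrow> (real \<Rightarrow> real) \<Rightarrow> ereal" where
  "Linf_norm_on J h = esssup (lebesgue_on J) (\<lambda>t. ereal \<bar>h t\<bar>)"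

definition in_Linf_on :: "real set \<Rightarrow> (real \<Rightarrow> real) \<Rightarrow> bool" where
  "in_Linf_on J h \<longleftrightarrow> h \<in> borel_measurable (lebesgue_on J) \<and> Linf_norm_on J h < \<infinity>"

text \<open>A locally absolutely continuous function is only known to be differentiable almost
  everywhere, so a function on \<open>J\<close> is called its derivative if it agrees almost everywhere with
  the pointwise one. In particular this holds if it is the derivative at every point of \<open>J\<close>
  (one-sided at an endpoint).\<close>

definition is_derivative_on :: "real set \<Rightarrow> (real \<Rightarrow> real) \<Rightarrow> (real \<Rightarrow> real) \<Rightarrow> bool" where
  "is_derivative_on J g g' \<longleftrightarrow>
     (AE t in lebesgue_on J. (g has_real_derivative g' t) (at t within J))"

end

theory Submission
  imports Defs
begin

text \<open>The variation hypothesis with a one-step partition makes \<open>g'\<close> Hoelder continuous with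
  exponent \<open>r\<close> and constant \<open>V\<close>. Since \<open>J\<close> is unbounded, every \<open>t \<in> J\<close> lies in closed subintervals
  of \<open>J\<close> of every length \<open>d > 0\<close>; integrating the Hoelder estimate over such an interval gives
  \<open>d \<bar>g' t\<bar> \<le> L + V d\<^bsup>r + 1\<^esup>\<close>, where \<open>L\<close> is the \<open>L\<^sub>1\<close> norm. The choice
  \<open>d\<^bsup>r + 1\<^esup> = L / (V r)\<close> is optimal.\<close>

lemma abs_diff_le_abs_total_variation:
  "ennreal \<bar>h b - h a\<bar> \<le> abs_total_variation a b h"
proof -
  let ?x = "\<lambda>i::nat. if i = 0 then min a b else max a b"
  have "ennreal \<bar>h b - h a\<bar> = (\<Sum>i<1. ennreal \<bar>h (?x (Suc i)) - h (?x i)\<bar>)"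
    by (auto simp: min_def max_def abs_minus_commute)
  also have "\<dots> \<le> total_variation (min a b) (max a b) h"
    unfolding total_variation_def by (rule SUP_upper2[of "(1, ?x)"]) auto
  finally show ?thesis
    by (simp add: abs_total_variation_def)
qed

text \<open>Unboundedness gives a point \<open>s\<close> of \<open>J\<close> with
  \<open>\<bar>s - t\<bar> > d\<close>, and convexity puts everything between \<open>t\<close> and
  \<open>s\<close> into \<open>J\<close>. The segment therefore starts at \<open>t\<close> and
  extends towards \<open>s\<close>.\<close>

lemma unbounded_interval_contains_segment:
  fixes J :: "real set"
  assumes "is_interval J" "\<not> bounded J" "t \<in> J" "0 \<le> d"
  obtains a where "{a..a + d} \<subseteq> J" "t \<in> {a..a + d}"
proof -
  obtain s where s: "s \<in> J" "\<bar>s\<bar> > \<bar>t\<bar> + d"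
    using assms(2) unfolding bounded_iff real_norm_def by (meson not_le)
  have mem: "x \<in> J" if "min s t \<le> x" "x \<le> max s t" for x
  proof (cases "s \<le> t")
    case True
    then show ?thesis
      using mem_is_interval_1_I[OF assms(1) s(1) assms(3), of x] that by simp
  next
    case False
    then show ?thesis
      using mem_is_interval_1_I[OF assms(1) assms(3) s(1), of x] that by simp
  qed
  show thesis
  proof (cases "s \<ge> t")
    case True
    then show thesis using s assms(4) by (intro that[of t]) (auto intro!: mem)
  next
    case False
    then show thesis using s assms(4) by (intro that[of "t - d"]) (auto intro!: mem)
  qed
qed

text \<open>Markov's inequality on a segment. The sign of \<open>c\<close> is free: off the segment
  the minorant is 0. This matters since the lower bound supplied later can be negative.\<close>

lemma length_mult_le_L1_norm_on:
  assumes "integrable (lebesgue_on J) h" "J \<in> sets lebesgue"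
    and "{a..b} \<subseteq> J" "a \<le> b" "\<And>s. s \<in> {a..b} \<Longrightarrow> c \<le> \<bar>h s\<bar>"
  shows "(b - a) * c \<le> L1_norm_on J h"
proof -
  have meas: "{a..b} \<in> sets (lebesgue_on J)"
    using assms(2,3) by (simp add: sets_restrict_space_iff)
  have m: "measure (lebesgue_on J) {a..b} = b - a" "emeasure (lebesgue_on J) {a..b} < \<infinity>"
    using assms(2,3,4) by (simp_all add: measure_restrict_space emeasure_restrict_space)
  then have int: "integrable (lebesgue_on J) (\<lambda>s. indicator {a..b} s * c)"
    using meas by (intro integrable_mult_left integrable_real_indicator)
  have "(b - a) * c = (LINT s|lebesgue_on J. indicator {a..b} s * c)"
    using m meas by (simp add: space_restrict_space assms(3) inf.absorb1)
  also have "\<dots> \<le> (LINT s|lebesgue_on J. \<bar>h s\<bar>)"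
    using assms(1,5) int
    by (intro integral_mono) (auto simp: indicator_def)
  finally show ?thesis
    by (simp add: L1_norm_on_def)
qed

lemma le_of_optimal_length:
  fixes L V M r :: real
  assumes "0 \<le> L" "0 < V" "0 < r"
    and le: "\<And>d. 0 < d \<Longrightarrow> d * (M - V * d powr r) \<le> L"
  shows "M \<le> (r + 1) / r powr (r / (r + 1)) * L powr (r / (r + 1)) * V powr (1 / (r + 1))"
proof (cases "L = 0")
  case True
  \<comment> \<open>For \<open>L = 0\<close> the optimal length degenerates to 0, and the right-hand
    side is 0 because \<open>0 powr p = 0\<close>.\<close>
  have "M \<le> 0"
  proof (rule ccontr)
    assume "\<not> M \<le> 0"
    \<comment> \<open>Chosen so that \<open>V * d powr r\<close> is half of
      \<open>M\<close>.\<close>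
    define d where "d = (M / (2 * V)) powr (1 / r)"
    have "d > 0" "d powr r = M / (2 * V)"
      using \<open>\<not> M \<le> 0\<close> assms(2,3) by (auto simp: d_def powr_powr)
    then have "d * (M / 2) \<le> 0"
      using le[of d] True assms(2) by simp
    with \<open>d > 0\<close> \<open>\<not> M \<le> 0\<close> show False
      by (simp add: mult_le_0_iff)
  qed
  with True show ?thesis by simp
next
  case False
  then have L: "L > 0" using assms(1) by simp
  define p where "p = r / (r + 1)"
  have q: "1 / (r + 1) = 1 - p" and pr: "(1 - p) * r = p"
    using assms(3) by (simp_all add: p_def field_simps)
  define d where "d = (L / (V * r)) powr (1 - p)"
  have d: "d > 0" using L assms(2,3) by (simp add: d_def)
  have d_r: "d powr r = (L / (V * r)) powr p"
    by (simp add: d_def powr_powr pr)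
  have base: "(L / (V * r)) powr p = L powr p / (V powr p * r powr p)"
    using L assms(2,3) by (simp add: powr_divide powr_mult)
  \<comment> \<open>Powers with exponent \<open>1 - p\<close> are rewritten as quotients, so that
    only \<open>p\<close>-th powers remain and cancel algebraically.\<close>
  have d_eq: "d = L / (V * r) / (L powr p / (V powr p * r powr p))"
    unfolding d_def base[symmetric] using L assms(2,3) by (subst powr_diff) simp
  have V_eq: "V powr (1 - p) = V / V powr p"
    using assms(2) by (simp add: powr_diff)
  have pos: "L powr p > 0" "V powr p > 0" "r powr p > 0"
    using L assms(2,3) by simp_all
  have "M \<le> L / d + V * d powr r"
    using le[OF d] d by (simp add: field_simps)
  \<comment> \<open>At the optimum both summands are multiples of one quantity, with factors
    \<open>r\<close> and 1; this yields the constant \<open>r + 1\<close>.\<close>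
  also have "L / d = r * (L powr p * V powr (1 - p) / r powr p)"
    unfolding d_eq V_eq using L assms(2,3) pos by simp
  also have "V * d powr r = L powr p * V powr (1 - p) / r powr p"
    unfolding d_r base V_eq using pos by simp
  finally show ?thesis
    unfolding q p_def[symmetric] by (simp add: algebra_simps add_divide_distrib)
qed

theorem theorem4:
  fixes J :: "real set" and g g' :: "real \<Rightarrow> real" and V r :: real
  assumes "is_interval J" and "\<not> bounded J"
    and "locally_abs_continuous_on J g"
    and "is_derivative_on J g g'"
    and "integrable (lebesgue_on J) g'"
    and "locally_bounded_variation_on J g'"
    and "V > 0" and "0 < r" and "r \<le> 1"
    and "\<And>a b. a \<in> J \<Longrightarrow> b \<in> J \<Longrightarrow>
           abs_total_variation a b g' \<le> ennreal (V * \<bar>a - b\<bar> powr r)"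
  shows "in_Linf_on J g' \<and>
         Linf_norm_on J g' \<le>
           ereal ((r + 1) / r powr (r / (r + 1))
                  * L1_norm_on J g' powr (r / (r + 1)) * V powr (1 / (r + 1)))"
    (is "_ \<and> _ \<le> ereal ?C")
proof -
  have J: "J \<in> sets lebesgue"
    using assms(1) by (simp add: real_interval_borel_measurable)
  have hoelder: "\<bar>g' b - g' a\<bar> \<le> V * \<bar>a - b\<bar> powr r" if "a \<in> J" "b \<in> J" for a b
    using order_trans[OF abs_diff_le_abs_total_variation assms(10)[OF that]] assms(7)
    by (simp add: ennreal_le_iff)
  have bound: "\<bar>g' t\<bar> \<le> ?C" if "t \<in> J" for t
  proof (rule le_of_optimal_length)
    show "0 \<le> L1_norm_on J g'"
      by (simp add: L1_norm_on_def)
    fix d :: real assume "0 < d"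
    obtain a where a: "{a..a + d} \<subseteq> J" "t \<in> {a..a + d}"
      using unbounded_interval_contains_segment[OF assms(1,2) \<open>t \<in> J\<close>] \<open>0 < d\<close>
      by (metis less_imp_le)
    \<comment> \<open>Reverse triangle inequality with the Hoelder bound, as \<open>t\<close> and
      \<open>s\<close> are at most \<open>d\<close> apart.\<close>
    have "\<bar>g' t\<bar> - V * d powr r \<le> \<bar>g' s\<bar>" if "s \<in> {a..a + d}" for s
    proof -
      have "\<bar>t - s\<bar> powr r \<le> d powr r"
        using a(2) that assms(8) by (intro powr_mono2) auto
      then have "V * \<bar>t - s\<bar> powr r \<le> V * d powr r"
        using assms(7) by simp
      with hoelder[of t s] a that show ?thesis
        using \<open>t \<in> J\<close> by fastforce
    qed
    from length_mult_le_L1_norm_on[OF assms(5) J a(1) _ this] \<open>0 < d\<close>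
    show "d * (\<bar>g' t\<bar> - V * d powr r) \<le> L1_norm_on J g'"
      by simp
  qed (use assms in auto)
  have meas: "g' \<in> borel_measurable (lebesgue_on J)"
    using assms(5) by auto
  have "Linf_norm_on J g' \<le> ereal ?C"
    unfolding Linf_norm_on_def using meas bound
    by (intro esssup_I) (auto intro!: AE_I2)
  moreover from this have "Linf_norm_on J g' < \<infinity>"
    by (rule le_less_trans) simp
  ultimately show ?thesis
    using meas by (simp add: in_Linf_on_def)
qed

end
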